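(* Let $m$, $n$, and $k$ be nonnegative integers such that $m\le n$ and $k\le n-m$. Then $$N^{(m)}_{n+k+m,k}(q) = \sum_{s=0}^k q^{(k-s)(k+m-s)}\, N^{(m)}_{n,k-s}(q) \begin{bmatrix} 2n+s\\ s\end{bmatrix}_q,$$ or, equivalently, $$N^{(m)}_{n+k+m,k}(q) = \sum_{s=0}^k q^{s(s+m)}\, N^{(m)}_{n,s}(q) \begin{bmatrix} 2n+k-s\\ 2n\end{bmatrix}_q.$$
   Context: $q$ is an indeterminate. $[i]_q=\frac{1-q^i}{1-q}$, $[k]_q!=\prod_{i=1}^k [i]_q$, and $\begin{bmatrix} n\\k\end{bmatrix}_q=\frac{[n]_q!}{[k]_q![n-k]_q!}$ for $0\le k\le n$. For nonnegative integers $m\le n$ and $k\le n-m$, the $q$-$m$-Narayana numbers are $N^{(m)}_{n,k}(q)=\begin{bmatrix} 2m\\ m\end{bmatrix}_q\begin{bmatrix} n\\ m\end{bmatrix}_q^{-1}\begin{bmatrix} n\\ k\end{bmatrix}_q\begin{bmatrix} n\\ k+m\end{bmatrix}_q$. *)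

theory Defs
  imports "HOL-Computational_Algebra.Computational_Algebra"
begin

(* The q-analogues are defined for an element q of an arbitrary field.  They have their
   intended meaning when no [i]_q with i > 0 vanishes and q is not 1 (otherwise division by
   zero makes them degenerate); this holds for the indeterminate qvar below. *)

definition q_int :: "'a::field \<Rightarrow> nat \<Rightarrow> 'a" where
  "q_int q i = (1 - q ^ i) / (1 - q)"

definition q_fact :: "'a::field \<Rightarrow> nat \<Rightarrow> 'a" where
  "q_fact q k = (\<Prod>i=1..k. q_int q i)"

(* Outside the range 0 <= k <= n, the quotient would be evaluated with truncated n - k; the
   usual convention of value 0 is used there instead. *)
definition q_binomial :: "'a::field \<Rightarrow> nat \<Rightarrow> nat \<Rightarrow> 'a" where
  "q_binomial q n k =
     (if k \<le> n then q_fact q n / (q_fact q k * q_fact q (n - k)) else 0)"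

(* q_narayana q m n k is N^(m)_{n,k}(q), meaningful for m <= n and k <= n - m. *)
definition q_narayana :: "'a::field \<Rightarrow> nat \<Rightarrow> nat \<Rightarrow> nat \<Rightarrow> 'a" where
  "q_narayana q m n k =
     q_binomial q (2 * m) m * inverse (q_binomial q n m)
       * q_binomial q n k * q_binomial q n (k + m)"

(* The indeterminate of the field Q(q) of rational functions over the rationals. *)
definition qvar :: "rat poly fract" where
  "qvar = Fract [:0, 1:] 1"

end

theory Submission
  imports Defs
begin

text \<open>Cancelling factorials turns the claim into the \<open>q\<close>-Saalschuetz identity
  \<open>\<Sum>\<^sub>s q\<^bsup>s(s+m)\<^esup> [a, s] [b, s+m] [a+b+k-s, k-s] = [a+m+k, k] [b+k, k+m]\<close> with \<open>a = b = n\<close>.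
  It follows from three applications of the \<open>q\<close>-Vandermonde convolution: expand
  \<open>[(a-s)+(b+k), k-s]\<close>, collect the terms by \<open>j = s + i\<close>, sum over \<open>s\<close>, and finally sum over \<open>j\<close>.
  The form of the convolution with exponent \<open>(x-i)(k-i)\<close> is the right one, because the exponent
  \<open>(a-j)(k-j)\<close> arising in the first step does not depend on \<open>s\<close>.\<close>

lemma q_binomial_eq_0: "n < k \<Longrightarrow> q_binomial q n k = 0"
  by (simp add: q_binomial_def)

lemma q_fact_Suc: "q_fact q (Suc n) = q_fact q n * q_int q (Suc n)"
  by (simp add: q_fact_def)

lemma q_binomial_symmetric: "k \<le> n \<Longrightarrow> q_binomial q n (n - k) = q_binomial q n k"
  by (simp add: q_binomial_def mult.commute)

lemma q_int_add: "q_int q (i + j) = q_int q i + q ^ i * q_int q j"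
  by (simp add: q_int_def add_divide_distrib [symmetric] algebra_simps power_add)

context
  fixes q :: "'a::field"
  assumes not_root_of_unity: "\<And>i. i > 0 \<Longrightarrow> q ^ i \<noteq> 1"
begin

text \<open>\<open>not_root_of_unity\<close> at exponent 1 protects the denominator, at exponent
  \<open>i\<close> the numerator.\<close>

lemma q_int_nonzero: "i > 0 \<Longrightarrow> q_int q i \<noteq> 0"
  using not_root_of_unity[of i] not_root_of_unity[of 1] by (simp add: q_int_def)

lemma q_fact_nonzero: "q_fact q n \<noteq> 0"
  by (simp add: q_fact_def q_int_nonzero)

lemma q_binomial_0: "q_binomial q n 0 = 1"
  using q_fact_nonzero[of n] by (simp add: q_binomial_def q_fact_def)

lemma q_binomial_self: "q_binomial q n n = 1"
  using q_fact_nonzero[of n] by (simp add: q_binomial_def q_fact_def)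

text \<open>Comes from splitting the top factor
  \<open>[n+1] = [n-k] + q^(n-k) [k+1]\<close>.\<close>

lemma q_pascal:
  "q_binomial q (Suc n) (Suc k) = q_binomial q n (Suc k) + q ^ (n - k) * q_binomial q n k"
proof (cases "k < n")
  case True
  then obtain d where n: "n = Suc (k + d)"
    using less_iff_Suc_add by auto
  have add: "q_int q (Suc (Suc (k + d))) = q_int q (Suc d) + q ^ Suc d * q_int q (Suc k)"
    using q_int_add[of q "Suc d" "Suc k"] by (simp add: add_ac)
  show ?thesis
    using q_fact_nonzero q_int_nonzero
    by (simp add: n q_binomial_def q_fact_Suc add Suc_diff_le divide_simps) (simp add: algebra_simps)
next
  case False
  then show ?thesis
    by (cases "k = n") (simp_all add: q_binomial_self q_binomial_eq_0)
qed

lemma q_vandermonde: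
  "q_binomial q (x + y) k =
     (\<Sum>i\<le>k. q ^ ((x - i) * (k - i)) * q_binomial q x i * q_binomial q y (k - i))"
proof (induction y arbitrary: k)
  case 0
  have "(\<Sum>i\<le>k. q ^ ((x - i) * (k - i)) * q_binomial q x i * q_binomial q 0 (k - i)) =
        (\<Sum>i\<in>{k}. q ^ ((x - i) * (k - i)) * q_binomial q x i * q_binomial q 0 (k - i))"
    by (rule sum.mono_neutral_right) (auto simp: q_binomial_eq_0)
  then show ?case
    by (simp add: q_binomial_0)
next
  case (Suc y)
  show ?case
  proof (cases k)
    case 0
    then show ?thesis by (simp add: q_binomial_0)
  next
    case (Suc l)
    let ?f = "\<lambda>i. q ^ ((x - i) * (k - i)) * q_binomial q x i * q_binomial q y (k - i)"
    let ?g = "\<lambda>i. q ^ (x + y - l) * (q ^ ((x - i) * (l - i)) * q_binomial q x i * q_binomial q y (l - i))"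
    have split: "q ^ ((x - i) * (k - i)) * q_binomial q x i * q_binomial q (Suc y) (k - i) = ?f i + ?g i"
      if "i \<le> l" for i
    \<comment> \<open>In this range no subtraction is truncated, so the exponents of Pascal's rule
      add up as required; outside it both sides vanish.\<close>
    proof (cases "i \<le> x \<and> l - i \<le> y")
      case True
      with that have "(x - i) + (y - (l - i)) = x + y - l"
        by arith
      with that have "(x - i) * (k - i) + (y - (l - i)) = (x + y - l) + (x - i) * (l - i)"
        by (simp add: Suc Suc_diff_le del: diff_diff_right)
      then have "q ^ ((x - i) * (k - i)) * q ^ (y - (l - i)) = q ^ (x + y - l) * q ^ ((x - i) * (l - i))"
        by (simp flip: power_add)
      moreover have "q_binomial q (Suc y) (k - i) =
          q_binomial q y (k - i) + q ^ (y - (l - i)) * q_binomial q y (l - i)"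
        using that q_pascal[of y "l - i"] by (simp add: Suc Suc_diff_le)
      ultimately show ?thesis
        by (simp add: algebra_simps)
    next
      case False
      with that Suc show ?thesis
        by (auto simp: q_binomial_eq_0)
    qed
    \<comment> \<open>The term \<open>i = k\<close> needs no Pascal step, since
      \<open>[y+1, 0] = [y, 0] = 1\<close>.\<close>
    have "(\<Sum>i\<le>k. q ^ ((x - i) * (k - i)) * q_binomial q x i * q_binomial q (Suc y) (k - i)) =
          (\<Sum>i\<le>l. ?f i + ?g i) + ?f k"
      using split by (simp add: Suc q_binomial_0)
    also have "\<dots> = (\<Sum>i\<le>k. ?f i) + (\<Sum>i\<le>l. ?g i)"
      by (simp add: Suc sum.distrib)
    also have "\<dots> = q_binomial q (x + y) k + q ^ (x + y - l) * q_binomial q (x + y) l"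
      by (simp add: Suc.IH sum_distrib_left)
    also have "\<dots> = q_binomial q (x + Suc y) k"
      by (simp add: Suc q_pascal)
    finally show ?thesis ..
  qed
qed

text \<open>The convolution for \<open>[j+b, j+m]\<close>: terms with \<open>i > j\<close> vanish,
  and \<open>i = j - s\<close> gives the exponent \<open>s(s+m)\<close>.\<close>

lemma q_vandermonde_shifted:
  "(\<Sum>s\<le>j. q ^ (s * (s + m)) * q_binomial q j s * q_binomial q b (s + m)) = q_binomial q (j + b) (j + m)"
proof -
  have "q_binomial q (j + b) (j + m) =
      (\<Sum>i\<le>j. q ^ ((j - i) * (j + m - i)) * q_binomial q j i * q_binomial q b (j + m - i))"
    unfolding q_vandermonde by (rule sum.mono_neutral_right) (auto simp: q_binomial_eq_0)
  also have "\<dots> = (\<Sum>s\<le>j. q ^ (s * (s + m)) * q_binomial q j s * q_binomial q b (s + m))"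
    by (rule sum.reindex_bij_witness[of _ "\<lambda>s. j - s" "\<lambda>i. j - i"])
       (auto simp: q_binomial_symmetric)
  finally show ?thesis ..
qed

text \<open>Once \<open>s + i\<close> is fixed, only the second factor on the right still depends on
  \<open>s\<close>.\<close>

lemma q_trinomial_revision:
  "q_binomial q a s * q_binomial q (a - s) i = q_binomial q a (s + i) * q_binomial q (s + i) s"
  using q_fact_nonzero by (auto simp: q_binomial_def)

text \<open>For \<open>m \<le> b\<close> both sides are
  \<open>[b+k]! / ([k-j]! [j+m]! [b-m]!)\<close>, otherwise both are 0. This frees a factor
  independent of \<open>j\<close>.\<close>

lemma q_binomial_mult_shift:
  assumes "j \<le> k"
  shows "q_binomial q (b + k) (k - j) * q_binomial q (b + j) (j + m) =
         q_binomial q (b + k) (k + m) * q_binomial q (k + m) (k - j)"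
proof -
  have "b + k - (k - j) = b + j" "k + m - (k - j) = j + m"
    using assms by auto
  then show ?thesis
    using assms q_fact_nonzero by (auto simp: q_binomial_def add.commute)
qed

lemma q_saalschuetz:
  "(\<Sum>s\<le>k. q ^ (s * (s + m)) * q_binomial q a s * q_binomial q b (s + m) *
       q_binomial q (a + b + k - s) (k - s)) =
   q_binomial q (a + m + k) k * q_binomial q (b + k) (k + m)"
proof -
  \<comment> \<open>The first three factors depend on \<open>s + i\<close> alone; the bracket
    collects what is summed over \<open>s\<close>.\<close>
  define t where "t s i = q ^ ((a - (s + i)) * (k - (s + i))) * q_binomial q a (s + i) *
      q_binomial q (b + k) (k - (s + i)) *
      (q ^ (s * (s + m)) * q_binomial q (s + i) s * q_binomial q b (s + m))" for s i
  have expand: "q ^ (s * (s + m)) * q_binomial q a s * q_binomial q b (s + m) *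
      q_binomial q (a + b + k - s) (k - s) = (\<Sum>i\<le>k - s. t s i)" if "s \<le> k" for s
  \<comment> \<open>For \<open>s > a\<close> the regrouping of \<open>a + b + k - s\<close> would
    truncate, but \<open>[a, s]\<close> and every \<open>[a, s+i]\<close> are 0.\<close>
  proof (cases "s \<le> a")
    case True
    then have "a + b + k - s = (a - s) + (b + k)"
      by simp
    then have "q_binomial q (a + b + k - s) (k - s) = (\<Sum>i\<le>k - s.
        q ^ ((a - s - i) * (k - s - i)) * q_binomial q (a - s) i * q_binomial q (b + k) (k - s - i))"
      by (simp only: q_vandermonde)
    moreover have "q ^ (s * (s + m)) * q_binomial q a s * q_binomial q b (s + m) *
        (q ^ ((a - s - i) * (k - s - i)) * q_binomial q (a - s) i * q_binomial q (b + k) (k - s - i)) =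
        t s i" for i
      using arg_cong[OF q_trinomial_revision[of a s i], of "\<lambda>z. z * (q ^ (s * (s + m)) *
        q_binomial q b (s + m) * q ^ ((a - s - i) * (k - s - i)) * q_binomial q (b + k) (k - s - i))"]
      by (simp add: t_def mult_ac)
    ultimately show ?thesis
      by (simp add: sum_distrib_left)
  next
    case False
    then show ?thesis
      by (simp add: t_def q_binomial_eq_0)
  qed
  have "(\<Sum>s\<le>k. q ^ (s * (s + m)) * q_binomial q a s * q_binomial q b (s + m) *
      q_binomial q (a + b + k - s) (k - s)) = (\<Sum>s\<le>k. \<Sum>i\<le>k - s. t s i)"
    by (simp add: expand)
  also have "\<dots> = (\<Sum>(s, i)\<in>{(s, i). s + i \<le> k}. t s i)"
    by (subst sum.Sigma) (auto intro!: sum.cong)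
  also have "\<dots> = (\<Sum>j\<le>k. \<Sum>s\<le>j. t s (j - s))"
    by (rule sum.triangle_reindex_eq)
  also have "\<dots> = (\<Sum>j\<le>k. q ^ ((a - j) * (k - j)) * q_binomial q a j *
      (q_binomial q (b + k) (k - j) * q_binomial q (b + j) (j + m)))"
  proof (intro sum.cong refl)
    fix j
    have "(\<Sum>s\<le>j. t s (j - s)) = q ^ ((a - j) * (k - j)) * q_binomial q a j *
        q_binomial q (b + k) (k - j) *
        (\<Sum>s\<le>j. q ^ (s * (s + m)) * q_binomial q j s * q_binomial q b (s + m))"
      by (simp add: t_def sum_distrib_left)
    then show "(\<Sum>s\<le>j. t s (j - s)) = q ^ ((a - j) * (k - j)) * q_binomial q a j *
        (q_binomial q (b + k) (k - j) * q_binomial q (b + j) (j + m))"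
      unfolding q_vandermonde_shifted by (simp add: add.commute mult.assoc)
  qed
  also have "\<dots> = q_binomial q (b + k) (k + m) *
      (\<Sum>j\<le>k. q ^ ((a - j) * (k - j)) * q_binomial q a j * q_binomial q (k + m) (k - j))"
    unfolding sum_distrib_left
    by (intro sum.cong refl) (simp add: q_binomial_mult_shift)
  \<comment> \<open>The remaining sum is the convolution for \<open>[a + (k+m), k]\<close>.\<close>
  also have "\<dots> = q_binomial q (a + m + k) k * q_binomial q (b + k) (k + m)"
    using q_vandermonde[of a "k + m" k] by (simp add: add_ac mult.commute)
  finally show ?thesis .
qed

text \<open>Apart from common factors, both sides reduce to
  \<open>[m]! [n+k]! / ([k+m]! [n]!)\<close>. The last bracket is the right side of
  \<open>q_saalschuetz\<close> at \<open>a = b = n\<close>.\<close>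

lemma q_narayana_shift:
  assumes "m \<le> n"
  shows "q_narayana q m (n + k + m) k = q_binomial q (2 * m) m * inverse (q_binomial q n m) *
     (q_binomial q (n + m + k) k * q_binomial q (n + k) (k + m))"
proof -
  have "n + k + m - (k + m) = n" "n + k + m - m = n + k" "n + k + m - k = n + m"
    "n + k - (k + m) = n - m" "n + m + k - k = n + m"
    by auto
  then show ?thesis
    using assms q_fact_nonzero by (simp add: q_narayana_def q_binomial_def divide_simps add_ac)
qed

lemma q_narayana_convolution:
  assumes "m \<le> n"
  shows "q_narayana q m (n + k + m) k =
    (\<Sum>s=0..k. q ^ (s * (s + m)) * q_narayana q m n s * q_binomial q (2 * n + k - s) (2 * n))"
proof -
  have "q_binomial q (2 * n + k - s) (2 * n) = q_binomial q (n + n + k - s) (k - s)" if "s \<le> k" for s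
    using that q_binomial_symmetric[of "k - s" "2 * n + k - s" q] by (simp add: mult_2)
  then show ?thesis
    unfolding q_narayana_shift[OF assms] q_saalschuetz[symmetric] atMost_atLeast0 sum_distrib_left
    unfolding q_narayana_def
    by (intro sum.cong) (simp_all add: mult_ac)
qed

end

lemma qvar_power: "qvar ^ i = Fract (monom 1 i) 1"
  by (induction i) (simp_all add: qvar_def One_fract_def monom_Suc)

text \<open>A monomial of positive degree is not constant; this discharges
  \<open>not_root_of_unity\<close> for \<open>qvar\<close>.\<close>

lemma qvar_power_neq_1: "i > 0 \<Longrightarrow> qvar ^ i \<noteq> 1"
  by (simp add: qvar_power One_fract_def eq_fract monom_eq_1_iff)

theorem proposition13:
  fixes m n k :: nat
  assumes "m \<le> n" and "k \<le> n - m"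
  shows "q_narayana qvar m (n + k + m) k =
           (\<Sum>s=0..k. qvar ^ ((k - s) * (k + m - s)) * q_narayana qvar m n (k - s)
                       * q_binomial qvar (2 * n + s) s)
       \<and> q_narayana qvar m (n + k + m) k =
           (\<Sum>s=0..k. qvar ^ (s * (s + m)) * q_narayana qvar m n s
                       * q_binomial qvar (2 * n + k - s) (2 * n))"
proof -
  have eq: "q_narayana qvar m (n + k + m) k =
      (\<Sum>s=0..k. qvar ^ (s * (s + m)) * q_narayana qvar m n s
                  * q_binomial qvar (2 * n + k - s) (2 * n))"
    using q_narayana_convolution[OF qvar_power_neq_1 assms(1)] .
  also have "\<dots> = (\<Sum>s=0..k. qvar ^ ((k - s) * (k + m - s)) * q_narayana qvar m n (k - s)
                  * q_binomial qvar (2 * n + s) s)"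
  \<comment> \<open>The two forms differ by reversing the summation and by the symmetry
    \<open>[2n+k-s, k-s] = [2n+k-s, 2n]\<close>.\<close>
  proof (rule sum.reindex_bij_witness[of _ "\<lambda>s. k - s" "\<lambda>s. k - s"])
    fix s assume "s \<in> {0..k}"
    then have "2 * n + (k - s) = 2 * n + k - s" "k + m - (k - s) = s + m" "k - (k - s) = s"
      by auto
    then show "qvar ^ ((k - (k - s)) * (k + m - (k - s))) * q_narayana qvar m n (k - (k - s))
          * q_binomial qvar (2 * n + (k - s)) (k - s) =
        qvar ^ (s * (s + m)) * q_narayana qvar m n s * q_binomial qvar (2 * n + k - s) (2 * n)"
      using q_binomial_symmetric[of "k - s" "2 * n + (k - s)" qvar] by (simp add: add.commute)
  qed auto
  finally show ?thesis
    using eq by simp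
qed

end
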